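(* Let $f(n)$, $n\in\mathbb{N}$, be a real sequence such that $|f(n)-f(m)|\gg 1$ for all $n\neq m$, and such that for some real $\tau>0$ and all sufficiently large $N$, $$\frac1N\sum_{n=1}^N|f(n)|\ll N^{\tau}.$$ Then for every real $\alpha\in(1/2,1)$, $$\dim\mathcal{F}_{f,\alpha}\leqslant 1-\frac{2\alpha-1}{\tau+1-\alpha},$$ where $\dim$ denotes Hausdorff dimension.
   Context: Write $\mathbf{e}(z)=\exp(2\pi i z)$ and $\mathsf{T}=[0,1]$. For a real sequence $f(n)$, $x\in\mathsf{T}$ and $N\in\mathbb{N}$ let $V_f(x;N)=\sum_{n=1}^N\mathbf{e}(xf(n))$, and for $\alpha\in(1/2,1)$ let $\mathcal{F}_{f,\alpha}=\{x\in\mathsf{T}:\ |V_f(x;N)|\geqslant N^\alpha\text{ for infinitely many }N\in\mathbb{N}\}$. The notation $U\ll V$ means $|U|\leqslant cV$ for some constant $c>0$ independent of the varying parameters. *)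

theory Defs
  imports "HOL-Analysis.Analysis"
begin

text \<open>
  The summand of the Hausdorff premeasure. It is the \<open>s\<close>-th power of the diameter with the
  convention \<open>0\<^sup>0 = 1\<close> for nonempty sets (note that \<open>0 powr 0 = 0\<close> in the library); the
  empty set contributes nothing, so finite covers may be padded by empty sets.
\<close>

definition hausdorff_gauge :: "real \<Rightarrow> 'a::metric_space set \<Rightarrow> ennreal" where
  "hausdorff_gauge s U =
     (if U = {} then 0 else if s = 0 then 1 else ennreal (diameter U powr s))"

text \<open>Boundedness of the covering sets is required because \<^const>\<open>diameter\<close> is real-valued
  and meaningless on unbounded sets.\<close>

definition hausdorff_premeasure :: "real \<Rightarrow> real \<Rightarrow> 'a::metric_space set \<Rightarrow> ennreal" where
  "hausdorff_premeasure s \<delta> A =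
     (INF U \<in> {U :: nat \<Rightarrow> 'a set. A \<subseteq> (\<Union>i. U i) \<and> (\<forall>i. bounded (U i) \<and> diameter (U i) \<le> \<delta>)}.
        \<Sum>i. hausdorff_gauge s (U i))"

definition hausdorff_measure :: "real \<Rightarrow> 'a::metric_space set \<Rightarrow> ennreal" where
  "hausdorff_measure s A = (SUP \<delta> \<in> {0<..}. hausdorff_premeasure s \<delta> A)"

definition hausdorff_dim :: "'a::metric_space set \<Rightarrow> ereal" where
  "hausdorff_dim A = Inf (ereal ` {s. 0 \<le> s \<and> hausdorff_measure s A = 0})"

definition e_char :: "complex \<Rightarrow> complex" where
  "e_char z = exp (2 * of_real pi * \<i> * z)"

definition exp_sum :: "(nat \<Rightarrow> real) \<Rightarrow> real \<Rightarrow> nat \<Rightarrow> complex" where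
  "exp_sum f x N = (\<Sum>n=1..N. e_char (of_real (x * f n)))"

definition large_sums_set :: "(nat \<Rightarrow> real) \<Rightarrow> real \<Rightarrow> real set" where
  "large_sums_set f \<alpha> =
     {x \<in> {0..1}. \<exists>\<^sub>\<infinity>N. cmod (exp_sum f x N) \<ge> real N powr \<alpha>}"

end

theory Submission
  imports Defs "HOL-Real_Asymp.Real_Asymp"
begin

text \<open>
  Let \<open>\<beta> = \<tau> + 1 - \<alpha>\<close>. For \<open>N \<approx> 2\<^sup>i\<close> the sum \<open>V(x; N)\<close> is Lipschitz in \<open>x\<close> with a constant
  of order \<open>2\<close> to the power \<open>i (\<tau> + 1)\<close>, so if it is at least \<open>N\<close> to the power \<open>\<alpha>\<close> at a point,
  it is at least half as large on a cell of length \<open>2\<close> to the power \<open>-i \<beta>\<close> around that point.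
  A separated sequence satisfies the mean value bound \<open>\<integral>\<bar>V\<bar>\<^sup>2 \<le> C N\<close>, which a dyadic decomposition
  upgrades, up to powers of \<open>i\<close>, to the maximum over all \<open>N < 2\<^sup>i\<close>. Chebyshev's inequality then
  bounds the number of such cells by \<open>2\<close> to the power \<open>i (1 - 2 \<alpha> + \<beta>)\<close>, up to powers of \<open>i\<close>,
  and these cells form the covers that make the \<open>s\<close>-dimensional Hausdorff measure vanish as soon
  as \<open>1 - 2 \<alpha> + \<beta> - s \<beta> < 0\<close>.
\<close>

subsection \<open>Hausdorff dimension of limsup sets\<close>

lemma hausdorff_premeasure_le_double_series:
  assumes "A \<subseteq> (\<Union>i k. V i k)"
    and "\<And>i k. bounded (V i k)" "\<And>i k. diameter (V i k) \<le> \<delta>"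
  shows "hausdorff_premeasure s \<delta> A \<le> (\<Sum>i k. hausdorff_gauge s (V i k))"
proof -
  define U where "U = (\<lambda>(i, k). V i k)"
  have "A \<subseteq> (\<Union>n. U (prod_decode n))"
  proof
    fix x assume "x \<in> A"
    then obtain i k where "x \<in> V i k"
      using assms(1) by blast
    then have "x \<in> U (prod_decode (prod_encode (i, k)))"
      by (simp add: U_def)
    then show "x \<in> (\<Union>n. U (prod_decode n))" by blast
  qed
  moreover have "bounded (U p)" "diameter (U p) \<le> \<delta>" for p
    using assms(2,3) by (simp_all add: U_def split: prod.split)
  ultimately have "hausdorff_premeasure s \<delta> A \<le> (\<Sum>n. hausdorff_gauge s (U (prod_decode n)))"
    unfolding hausdorff_premeasure_def by (intro INF_lower) auto
  also have "\<dots> = (\<Sum>i k. hausdorff_gauge s (V i k))"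
    by (rule suminf_ennreal_2dimen[of _ "\<lambda>p. hausdorff_gauge s (U p)"]) (simp add: U_def)
  finally show ?thesis .
qed

lemma hausdorff_premeasure_le_suminf:
  assumes "A \<subseteq> (\<Union>i k. V i k)"
    and "\<And>i k. bounded (V i k)" "\<And>i k. diameter (V i k) \<le> \<delta>"
    and "\<And>i. (\<Sum>k. hausdorff_gauge s (V i k)) \<le> ennreal (b i)"
    and "summable b" "\<And>i. 0 \<le> b i"
  shows "hausdorff_premeasure s \<delta> A \<le> ennreal (\<Sum>i. b i)"
proof -
  have "hausdorff_premeasure s \<delta> A \<le> (\<Sum>i k. hausdorff_gauge s (V i k))"
    using assms(1-3) by (rule hausdorff_premeasure_le_double_series)
  also have "\<dots> \<le> (\<Sum>i. ennreal (b i))"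
    by (intro suminf_le assms(4)) auto
  also have "\<dots> = ennreal (\<Sum>i. b i)"
    using assms(5,6) by (intro suminf_ennreal2)
  finally show ?thesis .
qed

lemma hausdorff_measure_limsup_eq_0:
  fixes A :: "'a::metric_space set" and V :: "nat \<Rightarrow> nat \<Rightarrow> 'a set"
  assumes cover: "\<And>x. x \<in> A \<Longrightarrow> \<exists>\<^sub>\<infinity>i. \<exists>k. x \<in> V i k"
    and bounded: "\<And>i k. bounded (V i k)"
    and diameter: "\<And>i k. diameter (V i k) \<le> \<delta> i" "\<delta> \<longlonglongrightarrow> 0"
    and gauge: "\<forall>\<^sub>F i in sequentially. (\<Sum>k. hausdorff_gauge s (V i k)) \<le> ennreal (b i)"
    and summable: "summable b" "\<And>i. 0 \<le> b i"
  shows "hausdorff_measure s A = 0"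
proof -
  have "hausdorff_premeasure s d A \<le> 0 + ennreal e" if "0 < d" "0 < e" for d e
  proof -
    have "\<forall>\<^sub>F m in sequentially. norm (\<Sum>i. b (i + m)) < e"
      using suminf_exist_split[OF \<open>0 < e\<close> summable(1)] unfolding eventually_sequentially by blast
    moreover have "\<forall>\<^sub>F m in sequentially. \<forall>i\<ge>m.
        \<delta> i < d \<and> (\<Sum>k. hausdorff_gauge s (V i k)) \<le> ennreal (b i)"
      using eventually_conj[OF order_tendstoD(2)[OF diameter(2) \<open>0 < d\<close>] gauge]
      by (rule eventually_all_ge_at_top)
    ultimately obtain m where tail: "norm (\<Sum>i. b (i + m)) < e"
      and \<delta>_less: "\<And>i. m \<le> i \<Longrightarrow> \<delta> i < d"
      and gauge_le: "\<And>i. m \<le> i \<Longrightarrow> (\<Sum>k. hausdorff_gauge s (V i k)) \<le> ennreal (b i)"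
      using eventually_happens'[OF sequentially_bot eventually_conj] by blast
    have "hausdorff_premeasure s d A \<le> ennreal (\<Sum>i. b (i + m))"
    proof (rule hausdorff_premeasure_le_suminf)
      show "A \<subseteq> (\<Union>i k. V (i + m) k)"
      proof
        fix x assume "x \<in> A"
        then obtain i k where "m \<le> i" "x \<in> V i k"
          using cover unfolding INFM_nat_le by blast
        then have "x \<in> V (i - m + m) k" by simp
        then show "x \<in> (\<Union>i k. V (i + m) k)" by blast
      qed
      show "diameter (V (i + m) k) \<le> d" for i k
        by (rule order_trans[OF diameter(1)]) (simp add: less_imp_le \<delta>_less)
      show "summable (\<lambda>i. b (i + m))"
        using summable(1) by (rule summable_ignore_initial_segment)
    qed (simp_all add: bounded summable(2) gauge_le)
    also have "\<dots> \<le> ennreal e"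
      using tail by (intro ennreal_leI) auto
    finally show ?thesis by simp
  qed
  then have "hausdorff_premeasure s d A = 0" if "0 < d" for d
    using that ennreal_le_epsilon[of 0 "hausdorff_premeasure s d A"] by force
  then show ?thesis
    unfolding hausdorff_measure_def by (intro SUP_eq_const) (auto intro: exI[of _ 1])
qed

lemma hausdorff_dim_leI:
  assumes "0 \<le> t" and null: "\<And>s. t < s \<Longrightarrow> hausdorff_measure s A = 0"
  shows "hausdorff_dim A \<le> ereal t"
proof (rule dense_ge)
  fix z assume "ereal t < z"
  then show "hausdorff_dim A \<le> z"
  proof (cases z)
    case (real s)
    with \<open>ereal t < z\<close> \<open>0 \<le> t\<close> show ?thesis
      unfolding hausdorff_dim_def by (intro Inf_lower) (auto intro: null)
  qed auto
qed

lemma hausdorff_gauge_le: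
  assumes "bounded U" "diameter U \<le> d" "0 < s"
  shows "hausdorff_gauge s U \<le> ennreal (d powr s)"
  using assms by (auto simp: hausdorff_gauge_def diameter_ge_0 intro!: ennreal_leI powr_mono2)

definition growth_exponent_le :: "(nat \<Rightarrow> nat) \<Rightarrow> real \<Rightarrow> bool" where
  "growth_exponent_le a \<gamma> \<longleftrightarrow>
     (\<forall>\<gamma>'>\<gamma>. \<forall>\<^sub>F i in sequentially. real (a i) \<le> 2 powr (real i * \<gamma>'))"

lemma growth_exponent_leI:
  fixes D :: real
  assumes "\<forall>\<^sub>F i in sequentially. real (a i) \<le> D * (real i + 1) ^ p * 2 powr (real i * \<gamma>)"
  shows "growth_exponent_le a \<gamma>"
  unfolding growth_exponent_le_def
proof (intro allI impI)
  fix \<gamma>' assume "\<gamma> < \<gamma>'"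
  define \<epsilon> where "\<epsilon> = \<gamma>' - \<gamma>"
  have "0 < \<epsilon>" using \<open>\<gamma> < \<gamma>'\<close> by (simp add: \<epsilon>_def)
  then have "\<forall>\<^sub>F i in sequentially. D * (real i + 1) ^ p \<le> 2 powr (real i * \<epsilon>)"
    by real_asymp
  with assms show "\<forall>\<^sub>F i in sequentially. real (a i) \<le> 2 powr (real i * \<gamma>')"
  proof eventually_elim
    case (elim i)
    note elim(1)
    also have "D * (real i + 1) ^ p * 2 powr (real i * \<gamma>) \<le>
        2 powr (real i * \<epsilon>) * 2 powr (real i * \<gamma>)"
      by (intro mult_right_mono elim(2)) simp
    also have "\<dots> = 2 powr (real i * \<gamma>')"
      by (simp add: \<epsilon>_def algebra_simps flip: powr_add)
    finally show ?case .
  qed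
qed

lemma growth_exponent_nonneg:
  assumes "growth_exponent_le a \<gamma>" and pos: "\<And>i. 0 < a i"
  shows "0 \<le> \<gamma>"
proof (rule ccontr)
  assume "\<not> 0 \<le> \<gamma>"
  then have "\<gamma> < \<gamma> / 2" "\<gamma> / 2 < 0" by auto
  then have "\<forall>\<^sub>F i in sequentially. real (a i) \<le> 2 powr (real i * (\<gamma> / 2))"
    using assms(1) unfolding growth_exponent_le_def by blast
  with eventually_gt_at_top[of 0] have "\<forall>\<^sub>F i::nat in sequentially. False"
  proof eventually_elim
    case (elim i)
    have "2 powr (real i * (\<gamma> / 2)) < 2 powr 0"
      using elim(1) \<open>\<gamma> / 2 < 0\<close> by (intro powr_less_mono mult_pos_neg) auto
    with elim(2) pos[of i] show False by simp
  qed
  then show False by simp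
qed

lemma suminf_hausdorff_gauge_le:
  fixes V :: "nat \<Rightarrow> 'a::metric_space set"
  assumes "finite J" "0 < s"
    and "\<And>k. k \<in> J \<Longrightarrow> bounded (V k)" "\<And>k. k \<in> J \<Longrightarrow> diameter (V k) \<le> d"
  shows "(\<Sum>k. hausdorff_gauge s (if k \<in> J then V k else {})) \<le> ennreal (real (card J) * d powr s)"
proof -
  have "(\<Sum>k. hausdorff_gauge s (if k \<in> J then V k else {})) = (\<Sum>k\<in>J. hausdorff_gauge s (V k))"
    using \<open>finite J\<close> by (subst suminf_finite[of J]) (simp_all add: hausdorff_gauge_def)
  also have "\<dots> \<le> (\<Sum>k\<in>J. ennreal (d powr s))"
    using assms by (intro sum_mono hausdorff_gauge_le) auto
  also have "\<dots> = ennreal (real (card J) * d powr s)"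
    by (simp add: ennreal_mult ennreal_of_nat_eq_real_of_nat)
  finally show ?thesis .
qed

lemma hausdorff_measure_limsup_growth_eq_0:
  fixes A :: "'a::metric_space set" and V :: "nat \<Rightarrow> nat \<Rightarrow> 'a set"
  assumes cover: "\<And>x. x \<in> A \<Longrightarrow> \<exists>\<^sub>\<infinity>i. \<exists>k\<in>J i. x \<in> V i k"
    and finite: "\<And>i. finite (J i)"
    and bounded: "\<And>i k. bounded (V i k)"
    and diameter: "\<And>i k. diameter (V i k) \<le> 2 powr (- (real i * \<beta>))"
    and growth: "growth_exponent_le (\<lambda>i. card (J i)) \<gamma>"
    and "0 < \<beta>" "0 < s" "\<gamma> < s * \<beta>"
  shows "hausdorff_measure s A = 0"
proof -
  obtain \<gamma>' where "\<gamma> < \<gamma>'" "\<gamma>' < s * \<beta>"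
    using dense[OF \<open>\<gamma> < s * \<beta>\<close>] by blast
  define U where "U i k = (if k \<in> J i then V i k else {})" for i k
  show ?thesis
  proof (rule hausdorff_measure_limsup_eq_0[where V = U and \<delta> = "\<lambda>i. (2 powr (- \<beta>)) ^ i"
        and b = "\<lambda>i. (2 powr (\<gamma>' - s * \<beta>)) ^ i"])
    show "\<exists>\<^sub>\<infinity>i. \<exists>k. x \<in> U i k" if "x \<in> A" for x
      using cover[OF that] by (rule INFM_mono) (auto simp: U_def)
    show "bounded (U i k)" for i k
      by (simp add: U_def bounded)
    show "diameter (U i k) \<le> (2 powr (- \<beta>)) ^ i" for i k
      using diameter[of i k] by (simp add: U_def powr_power mult.commute)
    show "(\<lambda>i. (2 powr (- \<beta>)) ^ i) \<longlonglongrightarrow> 0"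
      using powr_less_mono[of "- \<beta>" 0 2] \<open>0 < \<beta>\<close> by (intro LIMSEQ_power_zero) simp
    show "summable (\<lambda>i. (2 powr (\<gamma>' - s * \<beta>)) ^ i)"
      using powr_less_mono[of "\<gamma>' - s * \<beta>" 0 2] \<open>\<gamma>' < s * \<beta>\<close>
      by (intro summable_geometric) simp
    show "\<forall>\<^sub>F i in sequentially.
        (\<Sum>k. hausdorff_gauge s (U i k)) \<le> ennreal ((2 powr (\<gamma>' - s * \<beta>)) ^ i)"
      using growth[unfolded growth_exponent_le_def, rule_format, OF \<open>\<gamma> < \<gamma>'\<close>]
    proof eventually_elim
      case (elim i)
      have "(\<Sum>k. hausdorff_gauge s (U i k)) \<le>
          ennreal (real (card (J i)) * (2 powr (- (real i * \<beta>))) powr s)"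
        unfolding U_def using finite bounded diameter \<open>0 < s\<close> by (intro suminf_hausdorff_gauge_le)
      also have "\<dots> \<le> ennreal (2 powr (real i * \<gamma>') * (2 powr (- (real i * \<beta>))) powr s)"
        using elim by (intro ennreal_leI mult_right_mono) auto
      also have "2 powr (real i * \<gamma>') * (2 powr (- (real i * \<beta>))) powr s =
          (2 powr (\<gamma>' - s * \<beta>)) ^ i"
        by (simp add: powr_powr powr_power algebra_simps flip: powr_add)
      finally show ?case .
    qed
  qed simp
qed

lemma hausdorff_dim_limsup_le:
  fixes A :: "'a::metric_space set" and V :: "nat \<Rightarrow> nat \<Rightarrow> 'a set"
  assumes "\<And>x. x \<in> A \<Longrightarrow> \<exists>\<^sub>\<infinity>i. \<exists>k\<in>J i. x \<in> V i k"
    and "\<And>i. finite (J i)"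
    and "\<And>i k. bounded (V i k)"
    and "\<And>i k. diameter (V i k) \<le> 2 powr (- (real i * \<beta>))"
    and "growth_exponent_le (\<lambda>i. card (J i)) \<gamma>"
    and "0 < \<beta>" "0 \<le> \<gamma>"
  shows "hausdorff_dim A \<le> ereal (\<gamma> / \<beta>)"
proof (rule hausdorff_dim_leI)
  show "0 \<le> \<gamma> / \<beta>"
    using \<open>0 < \<beta>\<close> \<open>0 \<le> \<gamma>\<close> by simp
  fix s assume "\<gamma> / \<beta> < s"
  then have "\<gamma> < s * \<beta>" "0 < s"
    using \<open>0 < \<beta>\<close> \<open>0 \<le> \<gamma> / \<beta>\<close> by (simp add: field_simps, linarith)
  then show "hausdorff_measure s A = 0"
    using assms by (intro hausdorff_measure_limsup_growth_eq_0)
qed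

subsection \<open>Mean squares of exponential sums\<close>

definition separated_on :: "real \<Rightarrow> ('i \<Rightarrow> 'a::metric_space) \<Rightarrow> 'i set \<Rightarrow> bool" where
  "separated_on c f I \<longleftrightarrow> (\<forall>i\<in>I. \<forall>j\<in>I. i \<noteq> j \<longrightarrow> c \<le> dist (f i) (f j))"

lemma separated_on_subset: "separated_on c f I \<Longrightarrow> J \<subseteq> I \<Longrightarrow> separated_on c f J"
  by (auto simp: separated_on_def)

lemma sum_inverse_squares_nat_le:
  assumes "finite S"
  shows "(\<Sum>k\<in>S. 1 / (real k)\<^sup>2) \<le> pi\<^sup>2 / 6"
proof -
  have "(\<lambda>k. 1 / (real (Suc k))\<^sup>2) sums (pi\<^sup>2 / 6)"
    using inverse_squares_sums by (simp add: add.commute)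
  then have "(\<lambda>k. 1 / (real k)\<^sup>2) sums (pi\<^sup>2 / 6)"
    by (subst (asm) sums_Suc_iff) simp
  then show ?thesis
    using assms sum_le_suminf[of "\<lambda>k. 1 / (real k)\<^sup>2" S] by (auto simp: sums_iff)
qed

lemma sum_inverse_squares_separated_le:
  fixes g :: "'i \<Rightarrow> real"
  assumes "0 < c" "finite I" "separated_on c g I" and lower: "\<And>i. i \<in> I \<Longrightarrow> c \<le> g i"
  shows "(\<Sum>i\<in>I. 1 / (g i)\<^sup>2) \<le> pi\<^sup>2 / (6 * c\<^sup>2)"
proof -
  define k where "k i = nat \<lfloor>g i / c\<rfloor>" for i
  have floor_ge: "1 \<le> \<lfloor>g i / c\<rfloor>" if "i \<in> I" for i
    using lower[OF that] \<open>0 < c\<close> by simp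
  have k_pos: "0 < k i" and k_le: "real (k i) \<le> g i / c" if "i \<in> I" for i
    using floor_ge[OF that] unfolding k_def by linarith+
  have "inj_on k I"
  proof (rule inj_onI, rule ccontr)
    fix i j assume "i \<in> I" "j \<in> I" "k i = k j" "i \<noteq> j"
    then have "\<lfloor>g i / c\<rfloor> = \<lfloor>g j / c\<rfloor>"
      using floor_ge[of i] floor_ge[of j] by (simp add: k_def eq_nat_nat_iff)
    then have "\<bar>g i / c - g j / c\<bar> < 1"
      by linarith
    then have "\<bar>g i - g j\<bar> < c"
      using \<open>0 < c\<close> by (simp add: diff_divide_distrib[symmetric])
    with \<open>i \<in> I\<close> \<open>j \<in> I\<close> \<open>i \<noteq> j\<close> show False
      using assms(3) by (force simp: separated_on_def dist_real_def)
  qed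
  have "(\<Sum>i\<in>I. 1 / (g i)\<^sup>2) \<le> (\<Sum>i\<in>I. 1 / c\<^sup>2 * (1 / (real (k i))\<^sup>2))"
  proof (rule sum_mono)
    fix i assume "i \<in> I"
    then have "c * real (k i) \<le> g i"
      using k_le \<open>0 < c\<close> by (simp add: field_simps)
    moreover have "0 < g i"
      using lower[OF \<open>i \<in> I\<close>] \<open>0 < c\<close> by linarith
    ultimately have "1 / (g i)\<^sup>2 \<le> 1 / (c * real (k i))\<^sup>2"
      using k_pos[OF \<open>i \<in> I\<close>] \<open>0 < c\<close>
      by (intro divide_left_mono power_mono mult_pos_pos zero_less_power) auto
    then show "1 / (g i)\<^sup>2 \<le> 1 / c\<^sup>2 * (1 / (real (k i))\<^sup>2)"
      by (simp add: power_mult_distrib)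
  qed
  also have "\<dots> = 1 / c\<^sup>2 * (\<Sum>l\<in>k ` I. 1 / (real l)\<^sup>2)"
    using \<open>inj_on k I\<close> by (simp only: sum.reindex sum_distrib_left o_def)
  also have "\<dots> \<le> 1 / c\<^sup>2 * (pi\<^sup>2 / 6)"
    using \<open>finite I\<close> by (intro mult_left_mono sum_inverse_squares_nat_le) auto
  finally show ?thesis by (simp add: mult.commute)
qed

lemma sum_inverse_squared_gaps_le:
  fixes f :: "'i \<Rightarrow> real"
  assumes "0 < c" "finite I" "separated_on c f I" "n \<in> I"
  shows "(\<Sum>m\<in>I - {n}. 1 / (f n - f m)\<^sup>2) \<le> pi\<^sup>2 / (3 * c\<^sup>2)"
proof -
  define above where "above = {m \<in> I. f n < f m}"
  define below where "below = {m \<in> I. f m < f n}"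
  have gap: "c \<le> \<bar>f i - f j\<bar>" if "i \<in> I" "j \<in> I" "i \<noteq> j" for i j
    using assms(3) that by (auto simp: separated_on_def dist_real_def)
  have "(\<Sum>m\<in>above. 1 / (f m - f n)\<^sup>2) \<le> pi\<^sup>2 / (6 * c\<^sup>2)"
    using assms gap
    by (intro sum_inverse_squares_separated_le)
       (force simp: above_def separated_on_def dist_real_def)+
  then have sum_above: "(\<Sum>m\<in>above. 1 / (f n - f m)\<^sup>2) \<le> pi\<^sup>2 / (6 * c\<^sup>2)"
    by (simp add: power2_commute)
  have sum_below: "(\<Sum>m\<in>below. 1 / (f n - f m)\<^sup>2) \<le> pi\<^sup>2 / (6 * c\<^sup>2)"
    using assms gap
    by (intro sum_inverse_squares_separated_le)
       (force simp: below_def separated_on_def dist_real_def)+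
  have "f m \<noteq> f n" if "m \<in> I - {n}" for m
    using gap[of m n] that \<open>n \<in> I\<close> \<open>0 < c\<close> by auto
  then have "I - {n} = above \<union> below"
    by (fastforce simp: above_def below_def)
  moreover have "above \<inter> below = {}" "finite above" "finite below"
    using \<open>finite I\<close> by (auto simp: above_def below_def)
  ultimately show ?thesis
    using sum_above sum_below by (simp add: sum.union_disjoint)
qed

text \<open>
  The weight \<open>4 - x\<^sup>2\<close> is bounded below on \<open>[0, 1]\<close> and vanishes at \<open>\<plusminus>2\<close>, so that its cosine
  transform decays like \<open>\<theta>\<close> to the power \<open>-2\<close>, which is summable over separated frequencies; the
  sharp cutoff to \<open>[0, 1]\<close> would only give the power \<open>-1\<close>.
\<close>

definition parabola_transform :: "real \<Rightarrow> real" where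
  "parabola_transform \<theta> = integral {-2..2} (\<lambda>x. (4 - x\<^sup>2) * cos (x * \<theta>))"

lemma parabola_transform_minus: "parabola_transform (- \<theta>) = parabola_transform \<theta>"
  by (simp add: parabola_transform_def)

lemma parabola_transform_0: "parabola_transform 0 = 32 / 3"
proof -
  have "((\<lambda>x. 4 - x\<^sup>2) has_integral
      (4 * 2 - 2 ^ 3 / 3) - (4 * (- 2) - (- 2) ^ 3 / 3)) {-2..2::real}"
    by (intro fundamental_theorem_of_calculus)
       (auto intro!: derivative_eq_intros
             simp: has_real_derivative_iff_has_vector_derivative[symmetric])
  then show ?thesis
    by (simp add: parabola_transform_def integral_unique)
qed

lemma parabola_transform_nonzero:
  assumes "\<theta> \<noteq> 0"
  shows "parabola_transform \<theta> = 4 * sin (2 * \<theta>) / \<theta> ^ 3 - 8 * cos (2 * \<theta>) / \<theta>\<^sup>2"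
proof -
  define F where "F x = (4 - x\<^sup>2) * sin (x * \<theta>) / \<theta> - 2 * x * cos (x * \<theta>) / \<theta>\<^sup>2
     + 2 * sin (x * \<theta>) / \<theta> ^ 3" for x
  have "(F has_real_derivative (4 - x\<^sup>2) * cos (x * \<theta>)) (at x within {-2..2})" for x
    unfolding F_def using assms
    by (auto intro!: derivative_eq_intros simp: field_simps power2_eq_square power3_eq_cube)
  then have "((\<lambda>x. (4 - x\<^sup>2) * cos (x * \<theta>)) has_integral (F 2 - F (- 2))) {-2..2}"
    by (intro fundamental_theorem_of_calculus)
       (auto simp: has_real_derivative_iff_has_vector_derivative)
  then show ?thesis
    by (simp add: parabola_transform_def integral_unique F_def)
qed

lemma abs_parabola_transform_le:
  assumes "\<theta> \<noteq> 0"
  shows "\<bar>parabola_transform \<theta>\<bar> \<le> 16 / \<theta>\<^sup>2"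
proof -
  have "\<bar>parabola_transform \<theta>\<bar> \<le> 4 * \<bar>sin (2 * \<theta>)\<bar> / \<bar>\<theta>\<bar> ^ 3 + 8 * \<bar>cos (2 * \<theta>)\<bar> / \<theta>\<^sup>2"
    unfolding parabola_transform_nonzero[OF assms]
    by (rule order_trans[OF abs_triangle_ineq4]) (simp add: abs_mult power_abs)
  also have "\<dots> \<le> 4 * (2 * \<bar>\<theta>\<bar>) / \<bar>\<theta>\<bar> ^ 3 + 8 * 1 / \<theta>\<^sup>2"
    using abs_sin_x_le_abs_x[of "2 * \<theta>"] abs_cos_le_one[of "2 * \<theta>"]
    by (intro add_mono divide_right_mono mult_left_mono) auto
  also have "4 * (2 * \<bar>\<theta>\<bar>) / \<bar>\<theta>\<bar> ^ 3 = 8 / \<theta>\<^sup>2"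
    using assms by (simp add: power2_eq_square power3_eq_cube)
  finally show ?thesis by simp
qed

lemma integral_parabola_sin: "integral {-2..2} (\<lambda>x. (4 - x\<^sup>2) * sin (x * \<theta>)) = (0::real)"
  using Henstock_Kurzweil_Integration.integral_reflect_real
    [where a = "-2" and b = 2 and f = "\<lambda>x. (4 - x\<^sup>2) * sin (x * \<theta>)"] by simp

lemma cmod_sum_mult_cis_squared:
  "(cmod (\<Sum>n\<in>I. a n * cis (\<phi> n)))\<^sup>2 =
     (\<Sum>n\<in>I. \<Sum>m\<in>I. Re (a n * cnj (a m)) * cos (\<phi> n - \<phi> m)
        - Im (a n * cnj (a m)) * sin (\<phi> n - \<phi> m))"
proof -
  have "(cmod (\<Sum>n\<in>I. a n * cis (\<phi> n)))\<^sup>2 =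
      Re ((\<Sum>n\<in>I. a n * cis (\<phi> n)) * cnj (\<Sum>m\<in>I. a m * cis (\<phi> m)))"
    by (simp only: complex_norm_square[symmetric] Re_complex_of_real)
  also have "\<dots> = (\<Sum>n\<in>I. \<Sum>m\<in>I. Re (a n * cnj (a m) * cis (\<phi> n - \<phi> m)))"
    by (simp only: cnj_sum sum_product Re_sum)
       (simp add: cis_divide[symmetric] divide_inverse cis_cnj mult_ac)
  finally show ?thesis by simp
qed

lemma integral_parabola_mult_cmod_sum_squared:
  assumes "finite I"
  shows "integral {-2..2} (\<lambda>x. (4 - x\<^sup>2) * (cmod (\<Sum>n\<in>I. a n * cis (x * \<theta> n)))\<^sup>2) =
     (\<Sum>n\<in>I. \<Sum>m\<in>I. Re (a n * cnj (a m)) * parabola_transform (\<theta> n - \<theta> m))"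
proof -
  define C where "C n m x = Re (a n * cnj (a m)) * ((4 - x\<^sup>2) * cos (x * (\<theta> n - \<theta> m)))" for n m x
  define S where "S n m x = Im (a n * cnj (a m)) * ((4 - x\<^sup>2) * sin (x * (\<theta> n - \<theta> m)))" for n m x
  have integrable: "C n m integrable_on {-2..2}" "S n m integrable_on {-2..2}" for n m
    unfolding C_def S_def by (intro integrable_continuous_real continuous_intros)+
  have "(4 - x\<^sup>2) * (cmod (\<Sum>n\<in>I. a n * cis (x * \<theta> n)))\<^sup>2 =
      (\<Sum>n\<in>I. \<Sum>m\<in>I. C n m x - S n m x)" for x
    by (simp add: cmod_sum_mult_cis_squared sum_distrib_left C_def S_def algebra_simps)
  moreover have "integral {-2..2} (C n m) = Re (a n * cnj (a m)) * parabola_transform (\<theta> n - \<theta> m)"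
    "integral {-2..2} (S n m) = 0" for n m
    unfolding C_def S_def parabola_transform_def
    by (simp_all only: integral_mult_right integral_parabola_sin mult_zero_right)
  ultimately show ?thesis
    using assms integrable
    by (simp only: integral_sum integrable_sum integrable_diff
          Henstock_Kurzweil_Integration.integral_diff diff_zero)
qed

lemma schur_test_symmetric:
  fixes u :: "'i \<Rightarrow> real"
  assumes symmetric: "\<And>n m. k n m = k m n"
    and nonneg: "\<And>n m. 0 \<le> k n m"
    and row_sum: "\<And>n. n \<in> I \<Longrightarrow> (\<Sum>m\<in>I. k n m) \<le> R"
  shows "(\<Sum>n\<in>I. \<Sum>m\<in>I. u n * u m * k n m) \<le> R * (\<Sum>n\<in>I. (u n)\<^sup>2)"
proof -
  have "(\<Sum>n\<in>I. \<Sum>m\<in>I. u n * u m * k n m) \<le> (\<Sum>n\<in>I. \<Sum>m\<in>I. ((u n)\<^sup>2 + (u m)\<^sup>2) / 2 * k n m)"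
    using sum_squares_bound by (intro sum_mono mult_right_mono nonneg) (simp add: field_simps)
  also have "\<dots> = (\<Sum>n\<in>I. \<Sum>m\<in>I. (u n)\<^sup>2 * k n m) / 2 + (\<Sum>n\<in>I. \<Sum>m\<in>I. (u m)\<^sup>2 * k n m) / 2"
    by (simp add: add_divide_distrib distrib_right sum.distrib sum_divide_distrib)
  also have "(\<Sum>n\<in>I. \<Sum>m\<in>I. (u m)\<^sup>2 * k n m) = (\<Sum>n\<in>I. \<Sum>m\<in>I. (u n)\<^sup>2 * k n m)"
    by (subst sum.swap) (simp only: symmetric)
  also have "(\<Sum>n\<in>I. \<Sum>m\<in>I. (u n)\<^sup>2 * k n m) / 2 + (\<Sum>n\<in>I. \<Sum>m\<in>I. (u n)\<^sup>2 * k n m) / 2 =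
      (\<Sum>n\<in>I. (u n)\<^sup>2 * (\<Sum>m\<in>I. k n m))"
    by (simp add: sum_distrib_left)
  also have "\<dots> \<le> (\<Sum>n\<in>I. (u n)\<^sup>2 * R)"
    by (intro sum_mono mult_left_mono row_sum) auto
  also have "\<dots> = R * (\<Sum>n\<in>I. (u n)\<^sup>2)"
    by (simp add: sum_distrib_left mult.commute)
  finally show ?thesis .
qed

lemma sum_abs_parabola_transform_le:
  fixes f :: "'i \<Rightarrow> real"
  assumes "0 < c" "finite I" "separated_on c f I" "n \<in> I"
  shows "(\<Sum>m\<in>I. \<bar>parabola_transform (2 * pi * f n - 2 * pi * f m)\<bar>) \<le> (32 + 4 / c\<^sup>2) / 3"
proof -
  have "\<bar>parabola_transform (2 * pi * f n - 2 * pi * f m)\<bar> \<le> 4 / pi\<^sup>2 * (1 / (f n - f m)\<^sup>2)"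
    if "m \<in> I - {n}" for m
  proof -
    have "f n \<noteq> f m"
      using assms that by (force simp: separated_on_def)
    then have "\<bar>parabola_transform (2 * pi * (f n - f m))\<bar> \<le> 16 / (2 * pi * (f n - f m))\<^sup>2"
      by (intro abs_parabola_transform_le) simp
    then show ?thesis
      by (simp add: power_mult_distrib flip: right_diff_distrib)
  qed
  then have "(\<Sum>m\<in>I - {n}. \<bar>parabola_transform (2 * pi * f n - 2 * pi * f m)\<bar>) \<le>
      4 / pi\<^sup>2 * (\<Sum>m\<in>I - {n}. 1 / (f n - f m)\<^sup>2)"
    unfolding sum_distrib_left by (rule sum_mono)
  also have "\<dots> \<le> 4 / pi\<^sup>2 * (pi\<^sup>2 / (3 * c\<^sup>2))"
    using assms by (intro mult_left_mono sum_inverse_squared_gaps_le) auto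
  finally show ?thesis
    using assms by (simp add: sum.remove[of I n] parabola_transform_0 field_simps)
qed

lemma integral_unit_interval_le_parabola:
  fixes h :: "real \<Rightarrow> real"
  assumes "continuous_on {-2..2} h" "\<And>x. x \<in> {-2..2} \<Longrightarrow> 0 \<le> h x"
  shows "3 * integral {0..1} h \<le> integral {-2..2} (\<lambda>x. (4 - x\<^sup>2) * h x)"
proof -
  have integrable: "(\<lambda>x. w x * h x) integrable_on {a..b}"
    if "continuous_on {a..b} w" "{a..b} \<subseteq> {-2..2}" for w a b
    using that
    by (intro integrable_continuous_real continuous_intros continuous_on_subset[OF assms(1)])
  have "integral {0..1} (\<lambda>x. 3 * h x) \<le> integral {0..1} (\<lambda>x. (4 - x\<^sup>2) * h x)"
  proof (rule integral_le)
    fix x :: real assume "x \<in> {0..1}"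
    then show "3 * h x \<le> (4 - x\<^sup>2) * h x"
      using power_le_one[of x 2] assms(2)[of x] by (intro mult_right_mono) auto
  qed (intro integrable continuous_intros; simp)+
  also have "\<dots> \<le> integral {-2..2} (\<lambda>x. (4 - x\<^sup>2) * h x)"
  proof (intro integral_subset_le ballI integrable continuous_intros)
    fix x :: real assume "x \<in> {-2..2}"
    then have "x\<^sup>2 \<le> 2\<^sup>2" by (intro power2_le_iff_abs_le[THEN iffD2]) auto
    then show "0 \<le> (4 - x\<^sup>2) * h x" using assms(2)[OF \<open>x \<in> {-2..2}\<close>] by simp
  qed auto
  finally show ?thesis by simp
qed

definition mean_square_constant :: "real \<Rightarrow> real" where
  "mean_square_constant c = (32 + 4 / c\<^sup>2) / 9"

lemma mean_square_constant_nonneg: "0 \<le> mean_square_constant c"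
  by (simp add: mean_square_constant_def)

lemma e_char_of_real: "e_char (of_real t) = cis (2 * pi * t)"
  by (simp add: e_char_def cis_conv_exp mult_ac)

lemma Re_mult_cnj_mult_le: "Re (z * cnj w) * t \<le> cmod z * cmod w * \<bar>t\<bar>"
proof -
  have "\<bar>Re (z * cnj w)\<bar> \<le> cmod z * cmod w"
    using abs_Re_le_cmod[of "z * cnj w"] by (simp add: norm_mult)
  then have "\<bar>Re (z * cnj w) * t\<bar> \<le> cmod z * cmod w * \<bar>t\<bar>"
    by (simp only: abs_mult mult_right_mono abs_ge_zero)
  then show ?thesis by (rule order_trans[OF abs_ge_self])
qed

lemma mean_square_e_char_sum_le:
  fixes f :: "'i \<Rightarrow> real"
  assumes "0 < c" "finite I" "separated_on c f I"
  shows "integral {0..1} (\<lambda>x. (cmod (\<Sum>n\<in>I. a n * e_char (of_real (x * f n))))\<^sup>2)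
           \<le> mean_square_constant c * (\<Sum>n\<in>I. (cmod (a n))\<^sup>2)"
proof -
  define \<theta> where "\<theta> n = 2 * pi * f n" for n
  define S where "S x = (cmod (\<Sum>n\<in>I. a n * cis (x * \<theta> n)))\<^sup>2" for x
  have "3 * integral {0..1} S \<le> integral {-2..2} (\<lambda>x. (4 - x\<^sup>2) * S x)"
    unfolding S_def by (intro integral_unit_interval_le_parabola continuous_intros) simp
  also have "\<dots> = (\<Sum>n\<in>I. \<Sum>m\<in>I. Re (a n * cnj (a m)) * parabola_transform (\<theta> n - \<theta> m))"
    unfolding S_def by (rule integral_parabola_mult_cmod_sum_squared[OF \<open>finite I\<close>])
  also have "\<dots> \<le> (\<Sum>n\<in>I. \<Sum>m\<in>I. cmod (a n) * cmod (a m) * \<bar>parabola_transform (\<theta> n - \<theta> m)\<bar>)"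
    by (intro sum_mono Re_mult_cnj_mult_le)
  also have "\<dots> \<le> (32 + 4 / c\<^sup>2) / 3 * (\<Sum>n\<in>I. (cmod (a n))\<^sup>2)"
  proof (rule schur_test_symmetric)
    show "\<bar>parabola_transform (\<theta> n - \<theta> m)\<bar> = \<bar>parabola_transform (\<theta> m - \<theta> n)\<bar>" for n m
      using parabola_transform_minus[of "\<theta> n - \<theta> m"] by simp
    show "(\<Sum>m\<in>I. \<bar>parabola_transform (\<theta> n - \<theta> m)\<bar>) \<le> (32 + 4 / c\<^sup>2) / 3" if "n \<in> I" for n
      unfolding \<theta>_def using assms that by (rule sum_abs_parabola_transform_le)
  qed simp
  finally have "integral {0..1} S \<le> mean_square_constant c * (\<Sum>n\<in>I. (cmod (a n))\<^sup>2)"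
    by (simp add: mean_square_constant_def)
  moreover have "S x = (cmod (\<Sum>n\<in>I. a n * e_char (of_real (x * f n))))\<^sup>2" for x
    by (simp only: S_def \<theta>_def e_char_of_real mult_ac)
  ultimately show ?thesis by (simp only: S_def[abs_def])
qed

subsection \<open>Maximal partial sums\<close>

text \<open>
  The Rademacher--Menshov device: every interval \<open>(p, p + N]\<close> with \<open>N < 2\<^sup>i\<close> splits into at most
  \<open>i\<close> of the dyadic blocks whose sums are collected here, so Cauchy--Schwarz bounds all its partial
  sums at once, at the price of a factor \<open>i\<close>.
\<close>

fun dyadic_energy :: "(nat \<Rightarrow> 'a::real_normed_vector) \<Rightarrow> nat \<Rightarrow> nat \<Rightarrow> real" where
  "dyadic_energy v p 0 = 0"
| "dyadic_energy v p (Suc i) =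
     (norm (\<Sum>n=p+1..p+2^i. v n))\<^sup>2 + dyadic_energy v p i + dyadic_energy v (p + 2^i) i"

lemma dyadic_energy_nonneg: "0 \<le> dyadic_energy v p i"
  by (induction i arbitrary: p) auto

lemma norm_add_squared_le:
  fixes x y :: "'a::real_normed_vector"
  assumes "0 \<le> t" "0 \<le> e" "(norm y)\<^sup>2 \<le> t * e"
  shows "(norm (x + y))\<^sup>2 \<le> (t + 1) * ((norm x)\<^sup>2 + e)"
proof (cases "t = 0")
  case True
  with assms(3) have "y = 0" by simp
  with True \<open>0 \<le> e\<close> show ?thesis by simp
next
  case False
  then have "0 < t" using \<open>0 \<le> t\<close> by simp
  have "(norm (x + y))\<^sup>2 \<le> (norm x + norm y)\<^sup>2"
    by (intro power_mono norm_triangle_ineq) auto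
  also have "\<dots> = (t + 1) * ((norm x)\<^sup>2 + (norm y)\<^sup>2 / t) - (t * norm x - norm y)\<^sup>2 / t"
    using \<open>0 < t\<close> by (simp add: field_simps power2_eq_square)
  also have "\<dots> \<le> (t + 1) * ((norm x)\<^sup>2 + (norm y)\<^sup>2 / t)"
    using \<open>0 < t\<close> by simp
  also have "\<dots> \<le> (t + 1) * ((norm x)\<^sup>2 + e)"
    using assms(3) \<open>0 < t\<close> by (intro mult_left_mono add_mono) (auto simp: field_simps)
  finally show ?thesis .
qed

lemma norm_partial_sum_squared_le_dyadic_energy:
  assumes "N < 2 ^ i"
  shows "(norm (\<Sum>n=p+1..p+N. v n))\<^sup>2 \<le> real i * dyadic_energy v p i"
  using assms
proof (induction i arbitrary: p N)
  case (Suc i)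
  note nonneg = dyadic_energy_nonneg[of v]
  define head where "head = (\<Sum>n=p+1..p+2^i. v n)"
  show ?case
  proof (cases "N < 2 ^ i")
    case True
    have "(norm (\<Sum>n=p+1..p+N. v n))\<^sup>2 \<le> real i * dyadic_energy v p i"
      by (rule Suc.IH[OF True])
    also have "\<dots> \<le> real (Suc i) * dyadic_energy v p (Suc i)"
      using nonneg by (intro mult_mono) auto
    finally show ?thesis .
  next
    case False
    then obtain M where "N = 2 ^ i + M"
      by (metis le_Suc_ex not_less)
    with Suc.prems have "M < 2 ^ i" by simp
    define tail where "tail = (\<Sum>n=(p+2^i)+1..(p+2^i)+M. v n)"
    have split: "(\<Sum>n=p+1..p+N. v n) = head + tail"
      using sum.ub_add_nat[of "p+1" "p+2^i" v M]
      by (simp add: \<open>N = 2 ^ i + M\<close> head_def tail_def add.assoc)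
    have tail_le: "(norm tail)\<^sup>2 \<le> real i * dyadic_energy v (p + 2^i) i"
      unfolding tail_def by (rule Suc.IH[OF \<open>M < 2 ^ i\<close>])
    have "(norm (head + tail))\<^sup>2 \<le> (real i + 1) * ((norm head)\<^sup>2 + dyadic_energy v (p + 2^i) i)"
      using nonneg tail_le by (intro norm_add_squared_le) auto
    also have "\<dots> \<le> real (Suc i) * dyadic_energy v p (Suc i)"
      using nonneg by (intro mult_mono) (auto simp: head_def)
    finally show ?thesis unfolding split .
  qed
qed simp

lemma continuous_on_dyadic_energy:
  assumes "\<And>n. continuous_on A (\<lambda>x. v x n)"
  shows "continuous_on A (\<lambda>x. dyadic_energy (v x) p i)"
  by (induction i arbitrary: p) (simp_all add: continuous_intros assms)

lemma integral_dyadic_energy_le: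
  fixes v :: "real \<Rightarrow> nat \<Rightarrow> 'a::real_normed_vector"
  assumes continuous: "\<And>n. continuous_on {a..b} (\<lambda>x. v x n)"
    and nonneg: "\<And>n. 0 \<le> u n"
    and block: "\<And>p i. integral {a..b} (\<lambda>x. (norm (\<Sum>n=p+1..p+2^i. v x n))\<^sup>2)
                  \<le> (\<Sum>n=p+1..p+2^i. u n)"
  shows "integral {a..b} (\<lambda>x. dyadic_energy (v x) p i) \<le> real i * (\<Sum>n=p+1..p+2^i. u n)"
proof (induction i arbitrary: p)
  case (Suc i)
  define left where "left = (\<Sum>n=p+1..p+2^i. u n)"
  define right where "right = (\<Sum>n=p+2^i+1..p+2^i+2^i. u n)"
  have "0 \<le> right"
    unfolding right_def by (intro sum_nonneg nonneg)
  have whole: "(\<Sum>n=p+1..p+2^Suc i. u n) = left + right"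
    using sum.ub_add_nat[of "p+1" "p+2^i" u "2^i"]
    by (simp add: left_def right_def mult_2 add.assoc)
  have integrable: "(\<lambda>x. (norm (\<Sum>n=p+1..p+2^i. v x n))\<^sup>2) integrable_on {a..b}"
    "(\<lambda>x. dyadic_energy (v x) q i) integrable_on {a..b}" for q
    by (intro integrable_continuous_real continuous_intros continuous_on_dyadic_energy continuous)+
  have "integral {a..b} (\<lambda>x. dyadic_energy (v x) p (Suc i)) =
      integral {a..b} (\<lambda>x. (norm (\<Sum>n=p+1..p+2^i. v x n))\<^sup>2) +
      integral {a..b} (\<lambda>x. dyadic_energy (v x) p i) +
      integral {a..b} (\<lambda>x. dyadic_energy (v x) (p + 2^i) i)"
    unfolding dyadic_energy.simps by (simp only: integral_add integrable integrable_add)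
  also have "\<dots> \<le> left + real i * left + real i * right"
    unfolding left_def right_def by (intro add_mono block Suc.IH)
  also have "\<dots> \<le> real (Suc i) * (\<Sum>n=p+1..p+2^Suc i. u n)"
    using \<open>0 \<le> right\<close> unfolding whole by (simp add: algebra_simps)
  finally show ?case .
qed simp

lemma continuous_on_e_char_mult: "continuous_on A (\<lambda>x. e_char (of_real (x * t)))"
  unfolding e_char_def by (intro continuous_intros)

lemma integral_dyadic_energy_e_char_le:
  fixes f :: "nat \<Rightarrow> real"
  assumes "0 < c" "separated_on c f {1..}"
  shows "integral {0..1} (\<lambda>x. dyadic_energy (\<lambda>n. e_char (of_real (x * f n))) 0 i)
           \<le> mean_square_constant c * (real i * 2 ^ i)"
proof -
  have "integral {0..1} (\<lambda>x. (cmod (\<Sum>n=p+1..p+2^j. e_char (of_real (x * f n))))\<^sup>2)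
      \<le> (\<Sum>n=p+1..p+2^j. mean_square_constant c)" for p j
  proof -
    have "separated_on c f {p+1..p+2^j}"
      using assms(2) by (rule separated_on_subset) auto
    then show ?thesis
      using mean_square_e_char_sum_le[OF \<open>0 < c\<close>, of "{p+1..p+2^j}" f "\<lambda>_. 1"]
      by (simp add: mult.commute)
  qed
  then have "integral {0..1} (\<lambda>x. dyadic_energy (\<lambda>n. e_char (of_real (x * f n))) 0 i)
      \<le> real i * (\<Sum>n=(0::nat)+1..0+2^i. mean_square_constant c)"
    by (intro integral_dyadic_energy_le continuous_on_e_char_mult mean_square_constant_nonneg)
  then show ?thesis by (simp add: mult_ac)
qed

subsection \<open>Cells on which the exponential sums are large\<close>

lemma cmod_cis_diff_le: "cmod (cis a - cis b) \<le> \<bar>a - b\<bar>"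
proof -
  have "cis a - cis b = cis b * (cis (a - b) - 1)"
    by (simp add: algebra_simps cis_mult)
  then have "cmod (cis a - cis b) = 2 * \<bar>sin ((a - b) / 2)\<bar>"
    using dist_exp_i_1[of "a - b"] by (simp add: norm_mult cis_conv_exp)
  also have "\<dots> \<le> \<bar>a - b\<bar>"
    using abs_sin_x_le_abs_x[of "(a - b) / 2"] by simp
  finally show ?thesis .
qed

lemma cmod_exp_sum_diff_le:
  "cmod (exp_sum f x N - exp_sum f y N) \<le> 2 * pi * \<bar>x - y\<bar> * (\<Sum>n=1..N. \<bar>f n\<bar>)"
proof -
  have "cmod (exp_sum f x N - exp_sum f y N) \<le>
      (\<Sum>n=1..N. cmod (cis (2 * pi * (x * f n)) - cis (2 * pi * (y * f n))))"
    unfolding exp_sum_def e_char_of_real sum_subtractf[symmetric] by (rule norm_sum)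
  also have "\<dots> \<le> (\<Sum>n=1..N. 2 * pi * \<bar>x - y\<bar> * \<bar>f n\<bar>)"
  proof (rule sum_mono)
    fix n
    have "\<bar>2 * pi * (x * f n) - 2 * pi * (y * f n)\<bar> = 2 * pi * \<bar>x - y\<bar> * \<bar>f n\<bar>"
      by (simp add: abs_mult flip: right_diff_distrib left_diff_distrib)
    then show "cmod (cis (2 * pi * (x * f n)) - cis (2 * pi * (y * f n)))
        \<le> 2 * pi * \<bar>x - y\<bar> * \<bar>f n\<bar>"
      using cmod_cis_diff_le[of "2 * pi * (x * f n)" "2 * pi * (y * f n)"] by simp
  qed
  finally show ?thesis by (simp add: sum_distrib_left)
qed

definition cell :: "nat \<Rightarrow> nat \<Rightarrow> real set" where
  "cell K k = {real k / real K..real (Suc k) / real K}"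

lemma cell_width: "real (Suc k) / real K - real k / real K = 1 / real K"
  by (simp add: diff_divide_distrib[symmetric])

lemma diameter_cell: "diameter (cell K k) = 1 / real K"
  using cell_width[of k K] divide_right_mono[of "real k" "real (Suc k)" "real K"]
  by (simp add: cell_def diameter_closed_interval)

lemma abs_diff_le_cell_width:
  assumes "x \<in> cell K k" "y \<in> cell K k"
  shows "\<bar>x - y\<bar> \<le> 1 / real K"
  using assms cell_width[of k K] unfolding cell_def atLeastAtMost_iff by linarith

lemma cell_subset_unit_interval: "k < K \<Longrightarrow> cell K k \<subseteq> {0..1}"
  by (auto simp: cell_def field_simps)

lemma exists_cell_containing:
  assumes "x \<in> {0..1}" "0 < K"
  obtains k where "k < K" "x \<in> cell K k"
proof (cases "x = 1")
  case True
  with \<open>0 < K\<close> have "K - 1 < K" "x \<in> cell K (K - 1)"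
    by (auto simp: cell_def field_simps of_nat_diff)
  then show ?thesis by (rule that)
next
  case False
  define k where "k = nat \<lfloor>x * real K\<rfloor>"
  have k_bounds: "real k \<le> x * real K" "x * real K < real (Suc k)"
    using assms by (auto simp: k_def) linarith+
  moreover have "x * real K < real K" using False assms by simp
  ultimately have "k < K" by linarith
  moreover have "x \<in> cell K k"
    using k_bounds \<open>0 < K\<close> by (auto simp: cell_def field_simps)
  ultimately show ?thesis by (rule that)
qed

lemma sum_integral_cells:
  fixes h :: "real \<Rightarrow> 'a::banach"
  assumes "h integrable_on {0..1}" "0 < K" "j \<le> K"
  shows "(\<Sum>k<j. integral (cell K k) h) = integral {0..real j / real K} h"
  using \<open>j \<le> K\<close>
proof (induction j)
  case (Suc j)
  have "{0..real (Suc j) / real K} \<subseteq> {0..1}"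
    using Suc.prems by simp
  then have "h integrable_on {0..real (Suc j) / real K}"
    using assms(1) by (rule integrable_on_subinterval[rotated])
  then have "integral {0..real j / real K} h + integral (cell K j) h =
      integral {0..real (Suc j) / real K} h"
    unfolding cell_def
    by (intro Henstock_Kurzweil_Integration.integral_combine) (auto simp: divide_right_mono)
  then show ?case using Suc by simp
qed simp

lemma card_cells_mult_le_integral:
  fixes h :: "real \<Rightarrow> real"
  assumes integrable: "h integrable_on {0..1}" and nonneg: "\<And>x. x \<in> {0..1} \<Longrightarrow> 0 \<le> h x"
    and "0 < K" and subset: "J \<subseteq> {..<K}"
    and large: "\<And>k x. k \<in> J \<Longrightarrow> x \<in> cell K k \<Longrightarrow> L \<le> h x"
  shows "real (card J) * L \<le> real K * integral {0..1} h"
proof -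
  have integrable_cell: "h integrable_on cell K k" if "k < K" for k
    using integrable cell_subset_unit_interval[OF that]
    unfolding cell_def by (rule integrable_on_subinterval)
  have "L / real K \<le> integral (cell K k) h" if "k \<in> J" for k
  proof -
    have "integral (cell K k) (\<lambda>_. L) \<le> integral (cell K k) h"
      using that subset by (intro integral_le large integrable_cell) (auto simp: cell_def)
    then show ?thesis
      using cell_width[of k K] by (simp add: cell_def divide_right_mono)
  qed
  then have "real (card J) * (L / real K) \<le> (\<Sum>k\<in>J. integral (cell K k) h)"
    by (rule sum_bounded_below)
  also have "\<dots> \<le> (\<Sum>k<K. integral (cell K k) h)"
    using subset cell_subset_unit_interval nonneg
    by (intro sum_mono2 integral_nonneg integrable_cell) (auto simp: subset_iff)
  also have "\<dots> = integral {0..1} h"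
    using sum_integral_cells[OF integrable \<open>0 < K\<close> order_refl] \<open>0 < K\<close> by simp
  finally show ?thesis using \<open>0 < K\<close> by (simp add: field_simps)
qed

definition dyadic_block :: "nat \<Rightarrow> nat set" where
  "dyadic_block i = {2 ^ i..<2 ^ Suc i}"

lemma dyadic_block_bounds:
  assumes "N \<in> dyadic_block i"
  shows "i < N" "2 ^ i \<le> real N" "real N \<le> 2 ^ Suc i"
proof -
  have "2 ^ i \<le> N" "N \<le> 2 ^ Suc i"
    using assms by (simp_all add: dyadic_block_def)
  then have "real (2 ^ i) \<le> real N" "real N \<le> real (2 ^ Suc i)"
    by (simp_all only: of_nat_le_iff)
  then show "2 ^ i \<le> real N" "real N \<le> 2 ^ Suc i"
    by simp_all
  show "i < N"
    using less_exp \<open>2 ^ i \<le> N\<close> by (rule less_le_trans)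
qed

definition dyadic_large_set :: "(nat \<Rightarrow> real) \<Rightarrow> real \<Rightarrow> nat \<Rightarrow> real set" where
  "dyadic_large_set f \<alpha> i =
     {x \<in> {0..1}. \<exists>N\<in>dyadic_block i. real N powr \<alpha> \<le> cmod (exp_sum f x N)}"

lemma large_sums_set_frequently_dyadic:
  assumes "x \<in> large_sums_set f \<alpha>"
  shows "\<exists>\<^sub>\<infinity>i. x \<in> dyadic_large_set f \<alpha> i"
  unfolding INFM_nat_le
proof
  fix m
  from assms obtain N where "2 ^ m \<le> N" and large: "real N powr \<alpha> \<le> cmod (exp_sum f x N)"
    unfolding large_sums_set_def INFM_nat_le by blast
  have "1 \<le> N"
    using order_trans[OF one_le_power \<open>2 ^ m \<le> N\<close>] by simp
  then obtain i where "2 ^ i \<le> N" "N < 2 ^ Suc i"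
    using ex_power_ivl1[of 2 N] by auto
  have "(2::nat) ^ m < 2 ^ Suc i"
    using \<open>2 ^ m \<le> N\<close> \<open>N < 2 ^ Suc i\<close> by (rule le_less_trans)
  then have "m \<le> i"
    by (simp only: power_strict_increasing_iff one_less_numeral_iff semiring_norm less_Suc_eq_le)
  moreover have "N \<in> dyadic_block i"
    using \<open>2 ^ i \<le> N\<close> \<open>N < 2 ^ Suc i\<close> by (simp add: dyadic_block_def)
  then have "x \<in> dyadic_large_set f \<alpha> i"
    using assms large unfolding dyadic_large_set_def large_sums_set_def by blast
  ultimately show "\<exists>i\<ge>m. x \<in> dyadic_large_set f \<alpha> i" by blast
qed

lemma zero_in_dyadic_large_set:
  assumes "\<alpha> \<le> 1"
  shows "0 \<in> dyadic_large_set f \<alpha> i"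
proof -
  have "exp_sum f 0 (2 ^ i) = of_nat (2 ^ i)"
    by (simp add: exp_sum_def e_char_def)
  then have "cmod (exp_sum f 0 (2 ^ i)) = real (2 ^ i)"
    by (metis norm_of_nat)
  moreover have "real (2 ^ i) powr \<alpha> \<le> real (2 ^ i) powr 1"
    using assms by (intro powr_mono) auto
  ultimately show ?thesis
    unfolding dyadic_large_set_def dyadic_block_def by (auto intro!: bexI[of _ "2 ^ i"])
qed

definition large_cells :: "(nat \<Rightarrow> real) \<Rightarrow> real \<Rightarrow> nat \<Rightarrow> nat \<Rightarrow> nat set" where
  "large_cells f \<alpha> i K = {k \<in> {..<K}. cell K k \<inter> dyadic_large_set f \<alpha> i \<noteq> {}}"

lemma finite_large_cells: "finite (large_cells f \<alpha> i K)"
  by (simp add: large_cells_def)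

lemma dyadic_large_set_in_large_cell:
  assumes "0 < K" "x \<in> dyadic_large_set f \<alpha> i"
  shows "\<exists>k\<in>large_cells f \<alpha> i K. x \<in> cell K k"
proof -
  have "x \<in> {0..1}" using assms(2) by (simp add: dyadic_large_set_def)
  then obtain k where "k < K" "x \<in> cell K k"
    using \<open>0 < K\<close> by (rule exists_cell_containing)
  with assms(2) show ?thesis by (auto simp: large_cells_def)
qed

lemma card_large_cells_pos:
  assumes "0 < K" "\<alpha> \<le> 1"
  shows "0 < card (large_cells f \<alpha> i K)"
  using dyadic_large_set_in_large_cell[OF \<open>0 < K\<close> zero_in_dyadic_large_set[OF \<open>\<alpha> \<le> 1\<close>], of f i]
    finite_large_cells[of f \<alpha> i K] by (auto simp: card_gt_0_iff)

definition fine_mesh :: "(nat \<Rightarrow> real) \<Rightarrow> real \<Rightarrow> nat \<Rightarrow> nat \<Rightarrow> bool" where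
  "fine_mesh f \<alpha> i K \<longleftrightarrow>
     (\<forall>N\<in>dyadic_block i. \<forall>x y. \<bar>x - y\<bar> \<le> 1 / real K \<longrightarrow>
        cmod (exp_sum f x N - exp_sum f y N) \<le> real N powr \<alpha> / 2)"

lemma fine_meshI:
  assumes "0 < K"
    and sum_le: "\<And>N. N \<in> dyadic_block i \<Longrightarrow> 4 * pi * (\<Sum>n=1..N. \<bar>f n\<bar>) \<le> real K * real N powr \<alpha>"
  shows "fine_mesh f \<alpha> i K"
  unfolding fine_mesh_def
proof (intro ballI allI impI)
  fix N :: nat and x y :: real
  assume N_in_block: "N \<in> dyadic_block i" and "\<bar>x - y\<bar> \<le> 1 / real K"
  have "cmod (exp_sum f x N - exp_sum f y N) \<le> 2 * pi * \<bar>x - y\<bar> * (\<Sum>n=1..N. \<bar>f n\<bar>)"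
    by (rule cmod_exp_sum_diff_le)
  also have "\<dots> \<le> 2 * pi * (1 / real K) * (\<Sum>n=1..N. \<bar>f n\<bar>)"
    using \<open>\<bar>x - y\<bar> \<le> 1 / real K\<close> by (intro mult_right_mono mult_left_mono sum_nonneg) auto
  also have "\<dots> \<le> real N powr \<alpha> / 2"
    using sum_le[OF N_in_block] \<open>0 < K\<close> by (simp add: field_simps)
  finally show "cmod (exp_sum f x N - exp_sum f y N) \<le> real N powr \<alpha> / 2" .
qed

lemma dyadic_energy_ge_on_large_cell:
  assumes "fine_mesh f \<alpha> i K" "0 \<le> \<alpha>" "k \<in> large_cells f \<alpha> i K" "y \<in> cell K k"
  shows "2 powr (2 * \<alpha> * real i) / (4 * (real i + 1))
           \<le> dyadic_energy (\<lambda>n. e_char (of_real (y * f n))) 0 (Suc i)"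
proof -
  obtain x where "x \<in> cell K k" "x \<in> dyadic_large_set f \<alpha> i"
    using assms(3) unfolding large_cells_def by blast
  then obtain N where N_in_block: "N \<in> dyadic_block i"
    and large: "real N powr \<alpha> \<le> cmod (exp_sum f x N)"
    unfolding dyadic_large_set_def by blast
  have "cmod (exp_sum f x N - exp_sum f y N) \<le> real N powr \<alpha> / 2"
    using assms(1) N_in_block abs_diff_le_cell_width[OF \<open>x \<in> cell K k\<close> assms(4)]
    unfolding fine_mesh_def by blast
  with large have half_le: "real N powr \<alpha> / 2 \<le> cmod (exp_sum f y N)"
    using norm_triangle_ineq2[of "exp_sum f x N" "exp_sum f y N"] by linarith
  have "2 powr (\<alpha> * real i) = (2 ^ i) powr \<alpha>"
    by (simp add: powr_powr mult.commute flip: powr_realpow)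
  also have "\<dots> \<le> real N powr \<alpha>"
    using dyadic_block_bounds(2)[OF N_in_block] \<open>0 \<le> \<alpha>\<close> by (intro powr_mono2) auto
  finally have "2 powr (\<alpha> * real i) / 2 \<le> cmod (exp_sum f y N)"
    using half_le by linarith
  then have "(2 powr (\<alpha> * real i) / 2)\<^sup>2 \<le> (cmod (exp_sum f y N))\<^sup>2"
    by (intro power_mono) auto
  also have "\<dots> \<le> real (Suc i) * dyadic_energy (\<lambda>n. e_char (of_real (y * f n))) 0 (Suc i)"
    using norm_partial_sum_squared_le_dyadic_energy
      [of N "Suc i" "\<lambda>n. e_char (of_real (y * f n))" 0] N_in_block
    by (simp add: exp_sum_def dyadic_block_def del: dyadic_energy.simps)
  also have "(2 powr (\<alpha> * real i) / 2)\<^sup>2 = 2 powr (2 * \<alpha> * real i) / 4"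
    by (simp add: power_divide powr_power mult_ac)
  finally show ?thesis by (simp add: field_simps del: dyadic_energy.simps)
qed

lemma card_large_cells_le:
  assumes "0 < c" "separated_on c f {1..}" "fine_mesh f \<alpha> i K" "0 \<le> \<alpha>" "0 < K"
  shows "real (card (large_cells f \<alpha> i K))
           \<le> 8 * mean_square_constant c * (real i + 1)\<^sup>2 * 2 powr (real i * (1 - 2 * \<alpha>)) * real K"
proof -
  define h where "h x = dyadic_energy (\<lambda>n. e_char (of_real (x * f n))) 0 (Suc i)" for x
  define P where "P = 2 powr (2 * \<alpha> * real i)"
  have "real (card (large_cells f \<alpha> i K)) * (P / (4 * (real i + 1))) \<le> real K * integral {0..1} h"
  proof (rule card_cells_mult_le_integral)
    show "h integrable_on {0..1}"
      unfolding h_def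
      by (intro integrable_continuous_real continuous_on_dyadic_energy continuous_on_e_char_mult)
    show "0 \<le> h x" for x
      unfolding h_def by (rule dyadic_energy_nonneg)
    show "P / (4 * (real i + 1)) \<le> h x" if "k \<in> large_cells f \<alpha> i K" "x \<in> cell K k" for k x
      unfolding h_def P_def using assms that by (intro dyadic_energy_ge_on_large_cell)
  qed (use \<open>0 < K\<close> in \<open>auto simp: large_cells_def\<close>)
  also have "\<dots> \<le> real K * (mean_square_constant c * (real (Suc i) * 2 ^ Suc i))"
    unfolding h_def using assms by (intro mult_left_mono integral_dyadic_energy_e_char_le) auto
  finally have "real (card (large_cells f \<alpha> i K)) * P
      \<le> 8 * mean_square_constant c * (real i + 1)\<^sup>2 * 2 ^ i * real K"
    by (simp add: field_simps power2_eq_square)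
  then have "real (card (large_cells f \<alpha> i K))
      \<le> 8 * mean_square_constant c * (real i + 1)\<^sup>2 * (2 ^ i / P) * real K"
    by (simp add: P_def pos_le_divide_eq)
  also have "2 ^ i / P = 2 powr (real i * (1 - 2 * \<alpha>))"
    by (simp add: P_def algebra_simps powr_diff powr_realpow)
  finally show ?thesis .
qed

lemma growth_exponent_large_cells:
  assumes "0 < c" "separated_on c f {1..}" "0 \<le> \<alpha>"
    and fine: "\<forall>\<^sub>F i in sequentially. fine_mesh f \<alpha> i (K i)"
    and K_pos: "\<And>i. 0 < K i" and K_le: "\<And>i. real (K i) \<le> B * 2 powr (real i * \<beta>)"
  shows "growth_exponent_le (\<lambda>i. card (large_cells f \<alpha> i (K i))) (1 - 2 * \<alpha> + \<beta>)"
proof (rule growth_exponent_leI)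
  define D where "D = 8 * mean_square_constant c"
  show "\<forall>\<^sub>F i in sequentially. real (card (large_cells f \<alpha> i (K i)))
      \<le> D * B * (real i + 1)\<^sup>2 * 2 powr (real i * (1 - 2 * \<alpha> + \<beta>))"
    using fine
  proof eventually_elim
    case (elim i)
    have "real (card (large_cells f \<alpha> i (K i)))
        \<le> D * (real i + 1)\<^sup>2 * 2 powr (real i * (1 - 2 * \<alpha>)) * real (K i)"
      unfolding D_def using assms elim by (intro card_large_cells_le)
    also have "\<dots> \<le> D * (real i + 1)\<^sup>2 * 2 powr (real i * (1 - 2 * \<alpha>)) * (B * 2 powr (real i * \<beta>))"
      by (intro mult_left_mono K_le) (simp add: D_def mean_square_constant_nonneg)
    also have "\<dots> = D * B * (real i + 1)\<^sup>2 * 2 powr (real i * (1 - 2 * \<alpha> + \<beta>))"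
      by (simp add: distrib_left powr_add)
    finally show ?case .
  qed
qed

lemma fine_mesh_of_average_le:
  assumes "0 < C" "0 \<le> \<tau> + 1 - \<alpha>" "0 < K"
    and average_le: "\<And>N. N \<in> dyadic_block i \<Longrightarrow>
      (1 / real N) * (\<Sum>n=1..N. \<bar>f n\<bar>) \<le> C * real N powr \<tau>"
    and K_ge: "4 * pi * C * 2 powr (\<tau> + 1 - \<alpha>) * 2 powr (real i * (\<tau> + 1 - \<alpha>)) \<le> real K"
  shows "fine_mesh f \<alpha> i K"
proof (rule fine_meshI[OF \<open>0 < K\<close>])
  define \<beta> where "\<beta> = \<tau> + 1 - \<alpha>"
  fix N assume N_in_block: "N \<in> dyadic_block i"
  have "0 < N"
    using dyadic_block_bounds(1)[OF N_in_block] by simp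
  have "real N powr \<beta> \<le> (2 ^ Suc i) powr \<beta>"
    using dyadic_block_bounds(3)[OF N_in_block] assms(2) by (intro powr_mono2) (auto simp: \<beta>_def)
  also have "\<dots> = 2 powr \<beta> * 2 powr (real i * \<beta>)"
    by (simp add: powr_mult powr_powr[symmetric] powr_realpow)
  finally have N_powr_le: "real N powr \<beta> \<le> 2 powr \<beta> * 2 powr (real i * \<beta>)" .
  have "(\<Sum>n=1..N. \<bar>f n\<bar>) \<le> C * (real N powr \<tau> * real N)"
    using average_le[OF N_in_block] \<open>0 < N\<close> by (simp add: field_simps)
  also have "real N powr \<tau> * real N = real N powr \<beta> * real N powr \<alpha>"
    using \<open>0 < N\<close> by (simp add: \<beta>_def powr_add powr_diff)
  finally have "4 * pi * (\<Sum>n=1..N. \<bar>f n\<bar>) \<le> 4 * pi * C * real N powr \<beta> * real N powr \<alpha>"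
    by simp
  also have "\<dots> \<le> 4 * pi * C * (2 powr \<beta> * 2 powr (real i * \<beta>)) * real N powr \<alpha>"
    using \<open>0 < C\<close> by (intro mult_right_mono mult_left_mono N_powr_le) auto
  also have "\<dots> \<le> real K * real N powr \<alpha>"
    using K_ge by (intro mult_right_mono) (simp_all add: \<beta>_def mult.assoc)
  finally show "4 * pi * (\<Sum>n=1..N. \<bar>f n\<bar>) \<le> real K * real N powr \<alpha>" .
qed

lemma exists_nat_between_multiples:
  fixes A y :: real
  assumes "0 \<le> A" "1 \<le> y"
  shows "\<exists>n::nat. A * y \<le> real n \<and> real n \<le> (A + 1) * y"
proof (intro exI conjI)
  have "0 \<le> A * y" using assms by simp
  then have "real (nat \<lceil>A * y\<rceil>) \<le> A * y + 1"
    by linarith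
  then show "real (nat \<lceil>A * y\<rceil>) \<le> (A + 1) * y"
    using \<open>1 \<le> y\<close> by (simp add: distrib_right)
qed linarith

lemma exists_fine_mesh:
  assumes "\<exists>C>0. \<forall>\<^sub>F N in sequentially. (1 / real N) * (\<Sum>n=1..N. \<bar>f n\<bar>) \<le> C * real N powr \<tau>"
    and "0 \<le> \<tau> + 1 - \<alpha>"
  obtains K :: "nat \<Rightarrow> nat" and B where
    "\<And>i. 2 powr (real i * (\<tau> + 1 - \<alpha>)) \<le> real (K i)"
    "\<And>i. real (K i) \<le> B * 2 powr (real i * (\<tau> + 1 - \<alpha>))"
    "\<forall>\<^sub>F i in sequentially. fine_mesh f \<alpha> i (K i)"
proof -
  define \<beta> where "\<beta> = \<tau> + 1 - \<alpha>"
  obtain C N0 where "0 < C" and average_le: "\<And>N. N \<ge> N0 \<Longrightarrow>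
      (1 / real N) * (\<Sum>n=1..N. \<bar>f n\<bar>) \<le> C * real N powr \<tau>"
    using assms(1) unfolding eventually_sequentially by blast
  define A where "A = max 1 (4 * pi * C * 2 powr \<beta>)"
  have one_le_powr: "1 \<le> 2 powr (real i * \<beta>)" for i
    using assms(2) by (intro ge_one_powr_ge_zero) (auto simp: \<beta>_def)
  have "\<exists>n::nat. A * 2 powr (real i * \<beta>) \<le> real n \<and> real n \<le> (A + 1) * 2 powr (real i * \<beta>)" for i
    using one_le_powr by (intro exists_nat_between_multiples) (auto simp: A_def)
  then obtain K :: "nat \<Rightarrow> nat" where K_ge: "\<And>i. A * 2 powr (real i * \<beta>) \<le> real (K i)"
    and K_le: "\<And>i. real (K i) \<le> (A + 1) * 2 powr (real i * \<beta>)"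
    by metis
  have multiple_le_K: "t * 2 powr (real i * \<beta>) \<le> real (K i)" if "t \<le> A" for t i
    by (rule order_trans[OF mult_right_mono[OF that] K_ge]) simp
  then have powr_le_K: "2 powr (real i * \<beta>) \<le> real (K i)" for i
    using multiple_le_K[of 1 i] by (simp add: A_def)
  have "\<forall>\<^sub>F i in sequentially. fine_mesh f \<alpha> i (K i)"
    using eventually_ge_at_top[of N0]
  proof eventually_elim
    case (elim i)
    have "(1 / real N) * (\<Sum>n=1..N. \<bar>f n\<bar>) \<le> C * real N powr \<tau>" if "N \<in> dyadic_block i" for N
      using dyadic_block_bounds(1)[OF that] elim by (intro average_le) simp
    moreover have "0 < K i"
      using powr_le_K[of i] one_le_powr[of i] by linarith
    moreover have "4 * pi * C * 2 powr \<beta> * 2 powr (real i * \<beta>) \<le> real (K i)"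
      by (intro multiple_le_K) (simp add: A_def)
    ultimately show ?case
      using \<open>0 < C\<close> assms(2) unfolding \<beta>_def by (intro fine_mesh_of_average_le)
  qed
  with powr_le_K K_le that show thesis
    unfolding \<beta>_def by blast
qed

lemma hausdorff_dim_large_sums_set_le:
  assumes "0 < c" "separated_on c f {1..}" "0 \<le> \<alpha>" "\<alpha> \<le> 1" "0 < \<beta>"
    and fine: "\<forall>\<^sub>F i in sequentially. fine_mesh f \<alpha> i (K i)"
    and K_ge: "\<And>i. 2 powr (real i * \<beta>) \<le> real (K i)"
    and K_le: "\<And>i. real (K i) \<le> B * 2 powr (real i * \<beta>)"
  shows "hausdorff_dim (large_sums_set f \<alpha>) \<le> ereal ((1 - 2 * \<alpha> + \<beta>) / \<beta>)"
proof -
  have K_pos: "0 < K i" for i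
    using less_le_trans[OF _ K_ge[of i], of 0] by simp
  have growth: "growth_exponent_le (\<lambda>i. card (large_cells f \<alpha> i (K i))) (1 - 2 * \<alpha> + \<beta>)"
    using assms(1-3) fine K_pos K_le by (rule growth_exponent_large_cells)
  show ?thesis
  proof (rule hausdorff_dim_limsup_le[OF _ finite_large_cells _ _ growth \<open>0 < \<beta>\<close>])
    show "\<exists>\<^sub>\<infinity>i. \<exists>k\<in>large_cells f \<alpha> i (K i). x \<in> cell (K i) k"
      if "x \<in> large_sums_set f \<alpha>" for x
      using large_sums_set_frequently_dyadic[OF that] dyadic_large_set_in_large_cell[OF K_pos]
      by (rule INFM_mono)
    show "diameter (cell (K i) k) \<le> 2 powr (- (real i * \<beta>))" for i k
      using K_ge[of i] by (simp add: diameter_cell powr_minus_divide frac_le)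
    \<comment> \<open>The sums at \<open>x = 0\<close> are always large, so there is a large cell at every scale.\<close>
    show "0 \<le> 1 - 2 * \<alpha> + \<beta>"
      using growth card_large_cells_pos[OF K_pos \<open>\<alpha> \<le> 1\<close>] by (rule growth_exponent_nonneg)
  qed (simp add: cell_def)
qed

theorem theorem3p5:
  fixes f :: "nat \<Rightarrow> real" and \<tau> \<alpha> :: real
  assumes sep: "\<exists>c>0. \<forall>n\<ge>1. \<forall>m\<ge>1. n \<noteq> m \<longrightarrow> c \<le> \<bar>f n - f m\<bar>"
    and tau: "\<tau> > 0"
    and avg: "\<exists>C>0. \<forall>\<^sub>F N in sequentially.
                (1 / real N) * (\<Sum>n=1..N. \<bar>f n\<bar>) \<le> C * real N powr \<tau>"
    and alpha: "1 / 2 < \<alpha>" "\<alpha> < 1"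
  shows "hausdorff_dim (large_sums_set f \<alpha>) \<le> ereal (1 - (2 * \<alpha> - 1) / (\<tau> + 1 - \<alpha>))"
proof -
  define \<beta> where "\<beta> = \<tau> + 1 - \<alpha>"
  have "0 < \<beta>" using tau alpha by (simp add: \<beta>_def)
  obtain c where "0 < c" "separated_on c f {1..}"
    using sep by (auto simp: separated_on_def dist_real_def)
  moreover obtain K B where "\<And>i. 2 powr (real i * \<beta>) \<le> real (K i)"
    "\<And>i. real (K i) \<le> B * 2 powr (real i * \<beta>)"
    "\<forall>\<^sub>F i in sequentially. fine_mesh f \<alpha> i (K i)"
    using exists_fine_mesh[OF avg, of \<alpha>] \<open>0 < \<beta>\<close> unfolding \<beta>_def by auto
  ultimately have "hausdorff_dim (large_sums_set f \<alpha>) \<le> ereal ((1 - 2 * \<alpha> + \<beta>) / \<beta>)"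
    using alpha \<open>0 < \<beta>\<close> by (intro hausdorff_dim_large_sums_set_le[where K = K]) auto
  also have "(1 - 2 * \<alpha> + \<beta>) / \<beta> = 1 - (2 * \<alpha> - 1) / \<beta>"
    using \<open>0 < \<beta>\<close> by (simp add: field_simps)
  finally show ?thesis unfolding \<beta>_def .
qed

end
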